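(* Let $k \in \mathbb{Z}$ with $k \ge 3$. Then the subgroup of $SL_2(\mathbb{Z})$ generated by $A(k)$ and $B(k)$ has infinite index in the group of all matrices of the form $\begin{pmatrix} 1+k^2m_1 & km_2 \\ km_3 & 1+k^2m_4 \end{pmatrix}$ with determinant $1$, where $m_1,m_2,m_3,m_4$ range over the integers.
   Context: Notation: $A(k) = \begin{pmatrix} 1 & k \\ 0 & 1 \end{pmatrix}$ and $B(k) = \begin{pmatrix} 1 & 0 \\ k & 1 \end{pmatrix}$. *)

theory Defs
  imports "HOL-Analysis.Analysis" "HOL-Algebra.Generated_Groups"
begin

definition mat2 :: "int \<Rightarrow> int \<Rightarrow> int \<Rightarrow> int \<Rightarrow> int^2^2" where
  "mat2 a b c d = vector [vector [a, b], vector [c, d]]"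

definition SL2Z :: "(int^2^2) monoid" where
  "SL2Z = \<lparr>carrier = {M. det M = 1}, mult = (**), one = mat 1\<rparr>"

definition mat_A :: "int \<Rightarrow> int^2^2" where
  "mat_A k = mat2 1 k 0 1"

definition mat_B :: "int \<Rightarrow> int^2^2" where
  "mat_B k = mat2 1 0 k 1"

definition congr_set :: "int \<Rightarrow> (int^2^2) set" where
  "congr_set k =
    {M. (\<exists>m1 m2 m3 m4. M = mat2 (1 + k^2 * m1) (k * m2) (k * m3) (1 + k^2 * m4)) \<and> det M = 1}"

definition congr_group :: "int \<Rightarrow> (int^2^2) monoid" where
  "congr_group k = SL2Z\<lparr>carrier := congr_set k\<rparr>"

text \<open>
  The index of \<open>H\<close> in \<open>G\<close> is the cardinality of the set of its right cosets in \<open>G\<close>.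
  Since \<open>card\<close> is 0 on infinite sets, infinite index is stated as infinitude of that set.
\<close>

definition infinite_index :: "('a, 'b) monoid_scheme \<Rightarrow> 'a set \<Rightarrow> bool" where
  "infinite_index G H \<longleftrightarrow> subgroup H G \<and> infinite (rcosets\<^bsub>G\<^esub> H)"

lemma mat2_nth [simp]:
  "mat2 a b c d $ 1 $ 1 = a" "mat2 a b c d $ 1 $ 2 = b"
  "mat2 a b c d $ 2 $ 1 = c" "mat2 a b c d $ 2 $ 2 = d"
  by (simp_all add: mat2_def)

lemma mat2_eq_iff:
  "M = mat2 a b c d \<longleftrightarrow> M $ 1 $ 1 = a \<and> M $ 1 $ 2 = b \<and> M $ 2 $ 1 = c \<and> M $ 2 $ 2 = d"
  by (auto simp: vec_eq_iff forall_2)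

lemma mat2_mult:
  "mat2 a b c d ** mat2 a' b' c' d' =
    mat2 (a * a' + b * c') (a * b' + b * d') (c * a' + d * c') (c * b' + d * d')"
  by (simp add: mat2_eq_iff matrix_matrix_mult_def sum_2)

lemma det_mat2: "det (mat2 a b c d) = a * d - b * c"
  by (simp add: det_2)

lemma mat_1_mat2: "mat 1 = mat2 1 0 0 1"
  by (simp add: mat2_eq_iff mat_def)

lemma mat2_adjugate:
  assumes "a * d - b * c = 1"
  shows "mat2 d (- b) (- c) a ** mat2 a b c d = mat 1"
  using assms by (simp add: mat2_mult mat_1_mat2 mat2_eq_iff algebra_simps)

lemma mat2_exhaust: obtains a b c d where "M = mat2 a b c d"
  by (metis mat2_eq_iff)

lemma group_SL2Z: "group SL2Z"
proof (rule groupI)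
  fix M assume M: "M \<in> carrier SL2Z"
  obtain a b c d where abcd: "M = mat2 a b c d" by (rule mat2_exhaust)
  with M have "a * d - b * c = 1" by (simp add: SL2Z_def det_mat2)
  then show "\<exists>N\<in>carrier SL2Z. N \<otimes>\<^bsub>SL2Z\<^esub> M = \<one>\<^bsub>SL2Z\<^esub>"
    using mat2_adjugate[of a d b c]
    by (intro bexI[of _ "mat2 d (- b) (- c) a"]) (simp_all add: SL2Z_def abcd det_mat2 mult.commute)
qed (simp_all add: SL2Z_def det_mul matrix_mul_assoc)

lemma inv_SL2Z:
  assumes "a * d - b * c = 1"
  shows "inv\<^bsub>SL2Z\<^esub> (mat2 a b c d) = mat2 d (- b) (- c) a"
  by (rule group.inv_equality[OF group_SL2Z])
     (use assms mat2_adjugate[of a d b c] in \<open>simp_all add: SL2Z_def det_mat2 mult.commute\<close>)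

lemma subgroup_congr_set: "subgroup (congr_set k) SL2Z"
proof (rule group.subgroupI[OF group_SL2Z])
  show "congr_set k \<subseteq> carrier SL2Z"
    by (auto simp: congr_set_def SL2Z_def)
  have "mat 1 = mat2 (1 + k^2 * 0) (k * 0) (k * 0) (1 + k^2 * 0)"
    by (simp add: mat_1_mat2)
  then have "mat 1 \<in> congr_set k"
    unfolding congr_set_def using det_I by blast
  then show "congr_set k \<noteq> {}" by blast
next
  fix M assume "M \<in> congr_set k"
  then obtain m1 m2 m3 m4 where M: "M = mat2 (1 + k^2 * m1) (k * m2) (k * m3) (1 + k^2 * m4)"
    and "det M = 1" by (auto simp: congr_set_def)
  then have 1: "(1 + k^2 * m1) * (1 + k^2 * m4) - (k * m2) * (k * m3) = 1"
    by (simp add: det_mat2)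
  have "inv\<^bsub>SL2Z\<^esub> M = mat2 (1 + k^2 * m4) (k * (- m2)) (k * (- m3)) (1 + k^2 * m1)"
    unfolding M inv_SL2Z[OF 1] by simp
  moreover from this have "det (inv\<^bsub>SL2Z\<^esub> M) = 1"
    using 1 by (simp add: det_mat2 algebra_simps)
  ultimately show "inv\<^bsub>SL2Z\<^esub> M \<in> congr_set k"
    unfolding congr_set_def by blast
next
  fix M N assume "M \<in> congr_set k" and "N \<in> congr_set k"
  then obtain m1 m2 m3 m4 n1 n2 n3 n4 where
    M: "M = mat2 (1 + k^2 * m1) (k * m2) (k * m3) (1 + k^2 * m4)" "det M = 1" and
    N: "N = mat2 (1 + k^2 * n1) (k * n2) (k * n3) (1 + k^2 * n4)" "det N = 1"
    unfolding congr_set_def by blast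
  have "M ** N = mat2 (1 + k^2 * (m1 + n1 + k^2 * m1 * n1 + m2 * n3))
      (k * (n2 + k^2 * m1 * n2 + m2 + k^2 * m2 * n4))
      (k * (m3 + k^2 * m3 * n1 + n3 + k^2 * m4 * n3))
      (1 + k^2 * (m3 * n2 + m4 + n4 + k^2 * m4 * n4))"
    unfolding M(1) N(1) mat2_mult by (simp add: mat2_eq_iff algebra_simps power2_eq_square)
  moreover have "det (M ** N) = 1" using M N by (simp add: det_mul)
  ultimately show "M \<otimes>\<^bsub>SL2Z\<^esub> N \<in> congr_set k"
    unfolding congr_set_def by (auto simp: SL2Z_def)
qed

lemma group_congr_group: "group (congr_group k)"
  unfolding congr_group_def
  by (rule group.subgroup_imp_group[OF group_SL2Z subgroup_congr_set])

lemma mat_A_mat_B_in_congr_set: "{mat_A k, mat_B k} \<subseteq> congr_set k"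
proof -
  have "mat_A k = mat2 (1 + k^2 * 0) (k * 1) (k * 0) (1 + k^2 * 0)"
    "mat_B k = mat2 (1 + k^2 * 0) (k * 0) (k * 1) (1 + k^2 * 0)"
    by (simp_all add: mat_A_def mat_B_def)
  moreover have "det (mat_A k) = 1" "det (mat_B k) = 1"
    by (simp_all add: mat_A_def mat_B_def det_mat2)
  ultimately show ?thesis
    unfolding congr_set_def by blast
qed

end

(* The unipotent matrices fixing the vector (1, 1), namely
   [[1 + k^2 t, - k^2 t], [k^2 t, 1 - k^2 t]], form an infinite cyclic subgroup of the congruence
   group. The ping-pong argument shows that, for k > 2, every nontrivial element of
   the subgroup H generated by A(k), B(k) moves the vectors (x, y) with 2/k < |x/y| < k/2 out of
   this gap. As (1, 1) lies in the gap, H meets the cyclic group trivially, so the elements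
   of the latter represent pairwise distinct cosets of H. *)
theory Submission
  imports Defs
begin

lemma mat_A_mult: "mat_A a ** mat_A b = mat_A (a + b)"
  by (simp add: mat_A_def mat2_mult mat2_eq_iff)

lemma mat_B_mult: "mat_B a ** mat_B b = mat_B (a + b)"
  by (simp add: mat_B_def mat2_mult mat2_eq_iff)

lemma mat_A_0: "mat_A 0 = mat 1" and mat_B_0: "mat_B 0 = mat 1"
  by (simp_all add: mat_A_def mat_B_def mat_1_mat2)

lemma inv_mat_A: "inv\<^bsub>SL2Z\<^esub> (mat_A a) = mat_A (- a)"
  using inv_SL2Z[of 1 1 a 0] by (simp add: mat_A_def)

lemma inv_mat_B: "inv\<^bsub>SL2Z\<^esub> (mat_B a) = mat_B (- a)"
  using inv_SL2Z[of 1 1 0 a] by (simp add: mat_B_def)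

text \<open>
  The flag records the type of the leftmost syllable, \<open>True\<close> for a power of \<open>A(k)\<close> and \<open>False\<close>
  for a power of \<open>B(k)\<close>; the empty word carries both flags.
\<close>

inductive reduced_product :: "int \<Rightarrow> bool \<Rightarrow> int^2^2 \<Rightarrow> bool" for k where
  one: "reduced_product k s (mat 1)"
| A: "reduced_product k False M \<Longrightarrow> n \<noteq> 0 \<Longrightarrow> reduced_product k True (mat_A (k * n) ** M)"
| B: "reduced_product k True M \<Longrightarrow> n \<noteq> 0 \<Longrightarrow> reduced_product k False (mat_B (k * n) ** M)"

text \<open>A leading power of \<open>A(k)\<close> absorbs the new factor. If the exponents cancel,
  the syllable disappears, and what remains is empty or starts with a power of \<open>B(k)\<close>,
  so no further cancellation can follow.\<close>

lemma reduced_product_mat_A_mult: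
  assumes "reduced_product k s M"
  shows "\<exists>s'. reduced_product k s' (mat_A (k * n) ** M)"
proof -
  have *: "\<exists>s'. reduced_product k s' (mat_A (k * m) ** N)" if "reduced_product k False N" for m N
    by (cases "m = 0") (use that in \<open>auto simp: mat_A_0 intro: reduced_product.A\<close>)
  from assms show ?thesis
  proof cases
    case one
    then show ?thesis using * reduced_product.one by blast
  next
    case (A N m)
    then have "mat_A (k * n) ** M = mat_A (k * (n + m)) ** N"
      by (simp add: matrix_mul_assoc mat_A_mult distrib_left)
    then show ?thesis using * A by metis
  next
    case B
    then show ?thesis using * assms by blast
  qed
qed

lemma reduced_product_mat_B_mult:
  assumes "reduced_product k s M"
  shows "\<exists>s'. reduced_product k s' (mat_B (k * n) ** M)"
proof -
  have *: "\<exists>s'. reduced_product k s' (mat_B (k * m) ** N)" if "reduced_product k True N" for m N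
    by (cases "m = 0") (use that in \<open>auto simp: mat_B_0 intro: reduced_product.B\<close>)
  from assms show ?thesis
  proof cases
    case one
    then show ?thesis using * reduced_product.one by blast
  next
    case A
    then show ?thesis using * assms by blast
  next
    case (B N m)
    then have "mat_B (k * n) ** M = mat_B (k * (n + m)) ** N"
      by (simp add: matrix_mul_assoc mat_B_mult distrib_left)
    then show ?thesis using * B by metis
  qed
qed

lemma generate_imp_reduced_product:
  assumes "h \<in> generate SL2Z {mat_A k, mat_B k}"
  shows "\<exists>s. reduced_product k s h"
proof -
  \<comment> \<open>Stating the claim for left multiplication of an arbitrary \<open>M\<close> makes
    the product case a composition of two induction hypotheses; no product of two reduced words has
    to be reduced.\<close>
  have "\<exists>s'. reduced_product k s' (h ** M)" if "reduced_product k s M" for s M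
    using assms that
  proof (induction arbitrary: s M rule: generate.induct)
    case one
    then show ?case by (auto simp: SL2Z_def)
  next
    case (incl h)
    then show ?case
      using reduced_product_mat_A_mult[of k s M 1] reduced_product_mat_B_mult[of k s M 1] by auto
  next
    case (inv h)
    then show ?case
      using reduced_product_mat_A_mult[of k s M "-1"] reduced_product_mat_B_mult[of k s M "-1"]
      by (auto simp: inv_mat_A inv_mat_B)
  next
    case (eng h1 h2)
    then have "\<exists>s'. reduced_product k s' (h1 ** (h2 ** M))" by blast
    then show ?case by (simp add: SL2Z_def matrix_mul_assoc)
  qed
  from this[OF reduced_product.one] show ?thesis by simp
qed

text \<open>Reverse triangle inequality: the shift \<open>k * n * y\<close> has size at least
  \<open>k * \<bar>y\<bar>\<close>, while \<open>x\<close> takes away less than half of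
  that.\<close>

lemma ping_pong_step:
  fixes k n x y :: int
  assumes "2 * \<bar>x\<bar> < k * \<bar>y\<bar>" "k \<ge> 0" "n \<noteq> 0"
  shows "k * \<bar>y\<bar> < 2 * \<bar>x + k * n * y\<bar>"
proof -
  have "k * \<bar>y\<bar> * 1 \<le> k * \<bar>y\<bar> * \<bar>n\<bar>"
    using assms by (intro mult_left_mono) auto
  also have "\<dots> = \<bar>k * n * y\<bar>"
    using assms(2) by (simp add: abs_mult)
  finally have "k * \<bar>y\<bar> \<le> \<bar>k * n * y\<bar>" by simp
  moreover have "\<bar>k * n * y\<bar> \<le> \<bar>x + k * n * y\<bar> + \<bar>x\<bar>"
    using abs_triangle_ineq4[of "x + k * n * y" x] by simp
  moreover have "K < 2 * z" if "K \<le> c" "c \<le> z + w" "2 * w < K" for K c z w :: int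
    using that by linarith
  ultimately show ?thesis using assms(1) by blast
qed

lemma mat_A_mult_nth: "(mat_A a ** M) $ 1 $ j = M $ 1 $ j + a * M $ 2 $ j"
    "(mat_A a ** M) $ 2 $ j = M $ 2 $ j"
  by (simp_all add: mat_A_def matrix_matrix_mult_def sum_2)

lemma mat_B_mult_nth: "(mat_B a ** M) $ 1 $ j = M $ 1 $ j"
    "(mat_B a ** M) $ 2 $ j = M $ 2 $ j + a * M $ 1 $ j"
  by (simp_all add: mat_B_def matrix_matrix_mult_def sum_2)

text \<open>The row sums of \<open>M\<close> are the coordinates of the image of \<open>(1, 1)\<close>.\<close>

lemma reduced_product_ping_pong:
  assumes "reduced_product k s M" "k \<ge> 3"
  defines "x \<equiv> M $ 1 $ 1 + M $ 1 $ 2" and "y \<equiv> M $ 2 $ 1 + M $ 2 $ 2"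
  shows "M = mat 1 \<or> (if s then k * \<bar>y\<bar> < 2 * \<bar>x\<bar> else k * \<bar>x\<bar> < 2 * \<bar>y\<bar>)"
  using assms(1) unfolding x_def y_def
proof induction
  case (one s)
  then show ?case by simp
next
  case (A M n)
  let ?x = "M $ 1 $ 1 + M $ 1 $ 2" and ?y = "M $ 2 $ 1 + M $ 2 $ 2"
  \<comment> \<open>For the empty word both row sums are 1 and the claim is 2 < k. Otherwise the
    strict inequality comes from the preceding syllable, and k \<ge> 2 suffices to swap the factors
    2 and k.\<close>
  have "2 * \<bar>?x\<bar> < k * \<bar>?y\<bar>"
  proof (cases "M = mat 1")
    case False
    then have "k * \<bar>?x\<bar> < 2 * \<bar>?y\<bar>" using A by simp
    moreover have "2 * \<bar>?x\<bar> \<le> k * \<bar>?x\<bar>" "2 * \<bar>?y\<bar> \<le> k * \<bar>?y\<bar>"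
      using assms(2) by (simp_all add: mult_right_mono)
    ultimately show ?thesis by linarith
  qed (use assms(2) in \<open>simp add: mat_def\<close>)
  from ping_pong_step[OF this _ A(2)] assms(2) show ?case
    by (simp add: mat_A_mult_nth algebra_simps)
next
  case (B M n)
  let ?x = "M $ 1 $ 1 + M $ 1 $ 2" and ?y = "M $ 2 $ 1 + M $ 2 $ 2"
  have "2 * \<bar>?y\<bar> < k * \<bar>?x\<bar>"
  proof (cases "M = mat 1")
    case False
    then have "k * \<bar>?y\<bar> < 2 * \<bar>?x\<bar>" using B by simp
    moreover have "2 * \<bar>?x\<bar> \<le> k * \<bar>?x\<bar>" "2 * \<bar>?y\<bar> \<le> k * \<bar>?y\<bar>"
      using assms(2) by (simp_all add: mult_right_mono)
    ultimately show ?thesis by linarith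
  qed (use assms(2) in \<open>simp add: mat_def\<close>)
  from ping_pong_step[OF this _ B(2)] assms(2) show ?case
    by (simp add: mat_B_mult_nth algebra_simps)
qed

text \<open>This is I + r N with N = [[1, -1], [1, -1]] and N^2 = 0, so parameters add under
  multiplication.\<close>

definition shear :: "int \<Rightarrow> int^2^2" where
  "shear r = mat2 (1 + r) (- r) r (1 - r)"

lemma shear_mult: "shear r ** shear r' = shear (r + r')"
  by (simp add: shear_def mat2_mult mat2_eq_iff algebra_simps)

lemma shear_0: "shear 0 = mat 1"
  by (simp add: shear_def mat_1_mat2)

lemma shear_in_congr_set: "shear (k^2 * t) \<in> congr_set k"
proof -
  have "shear (k^2 * t) = mat2 (1 + k^2 * t) (k * (- (k * t))) (k * (k * t)) (1 + k^2 * (- t))"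
    by (simp add: shear_def mat2_eq_iff power2_eq_square)
  moreover have "det (shear (k^2 * t)) = 1"
    by (simp add: shear_def det_mat2 algebra_simps)
  ultimately show ?thesis unfolding congr_set_def by blast
qed

text \<open>Both row sums of \<open>shear r\<close> are 1, so either ping-pong inequality would give
  k < 2; only the identity is left.\<close>

lemma shear_in_generate_imp_0:
  assumes "shear r \<in> generate SL2Z {mat_A k, mat_B k}" "k \<ge> 3"
  shows "r = 0"
proof -
  obtain s where "reduced_product k s (shear r)"
    using generate_imp_reduced_product[OF assms(1)] by blast
  from reduced_product_ping_pong[OF this assms(2)] assms(2) have "shear r = mat 1"
    by (simp add: shear_def split: if_splits)
  then show ?thesis by (simp add: shear_def mat_1_mat2 mat2_eq_iff)
qed

theorem theorem3:
  fixes k :: int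
  assumes "k \<ge> 3"
  shows "infinite_index (congr_group k) (generate SL2Z {mat_A k, mat_B k})"
proof -
  let ?H = "generate SL2Z {mat_A k, mat_B k}"
  let ?coset = "\<lambda>t. ?H #>\<^bsub>congr_group k\<^esub> shear (k^2 * t)"
  interpret SL2Z: group SL2Z by (rule group_SL2Z)
  have sub: "{mat_A k, mat_B k} \<subseteq> carrier SL2Z"
    using mat_A_mat_B_in_congr_set subgroup.subset[OF subgroup_congr_set] by blast
  have H: "subgroup ?H (congr_group k)"
    unfolding congr_group_def
    by (intro SL2Z.subgroup_incl SL2Z.generate_is_subgroup SL2Z.generate_subgroup_incl
        sub subgroup_congr_set mat_A_mat_B_in_congr_set)
  have mult: "x \<otimes>\<^bsub>congr_group k\<^esub> y = x ** y" for x y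
    by (simp add: congr_group_def SL2Z_def)
  have "inj ?coset"
  proof (rule injI)
    fix t u assume eq: "?coset t = ?coset u"
    have "mat 1 \<in> ?H" using generate.one[of SL2Z] by (simp add: SL2Z_def)
    then have "shear (k^2 * t) \<in> ?coset u"
      unfolding eq[symmetric] by (auto simp: r_coset_def mult intro: bexI[of _ "mat 1"])
    then obtain h where h: "h \<in> ?H" "shear (k^2 * t) = h ** shear (k^2 * u)"
      by (auto simp: r_coset_def mult)
    \<comment> \<open>Cancelling \<open>shear (k^2 * u)\<close> on the right exhibits
      \<open>h\<close> itself as a shear lying in \<open>?H\<close>.\<close>
    have "h = h ** (shear (k^2 * u) ** shear (- (k^2 * u)))"
      by (simp add: shear_mult shear_0)
    also have "\<dots> = shear (k^2 * t) ** shear (- (k^2 * u))"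
      by (simp add: h(2) matrix_mul_assoc)
    finally have "h = shear (k^2 * (t - u))"
      by (simp add: shear_mult algebra_simps)
    with h(1) have "k^2 * (t - u) = 0"
      using shear_in_generate_imp_0 assms by blast
    then show "t = u" using assms by simp
  qed
  moreover have "range ?coset \<subseteq> rcosets\<^bsub>congr_group k\<^esub> ?H"
    using shear_in_congr_set by (auto simp: RCOSETS_def congr_group_def)
  ultimately have "infinite (rcosets\<^bsub>congr_group k\<^esub> ?H)"
    by (meson finite_subset finite_imageD infinite_UNIV_int)
  with H show ?thesis by (simp add: infinite_index_def)
qed

end
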